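(* Fix $R\in\mathbb N$ and $0<p<1$, let $q=1-p$, $X\sim\mathrm{Bin}(N,p)$, $\nu=\lceil Np\rceil$ and $h=h_N=\nu-Np\in[0,1)$. Put $$A_1(t;p)=\frac1{12}-\frac{B_2(t)}{2pq}-\frac tp .$$ Then, as $N\to\infty$, $$\Pr\{|X-\nu|\le R\}=\frac1{\sqrt{2\pi Npq}}\left[(2R+1)+\frac1N\sum_{r=-R}^{R}A_1(h+r;p)+O(N^{-2})\right],$$ and $$\sum_{r=-R}^{R}A_1(h+r;p)=(2R+1)\left[\frac1{12}-\frac{B_2(h)}{2pq}-\frac hp\right]-\frac{R(R+1)(2R+1)}{6\,pq}.$$
   Context: $B_2(t)=t^2-t+\tfrac16$ is the second Bernoulli polynomial. *)

theory Defs
  imports "HOL-Probability.Probability" "HOL-Library.Landau_Symbols"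
begin

definition bernpoly2 :: "real \<Rightarrow> real" where
  "bernpoly2 t = t\<^sup>2 - t + 1 / 6"

definition A1 :: "real \<Rightarrow> real \<Rightarrow> real" where
  "A1 t p = 1 / 12 - bernpoly2 t / (2 * p * (1 - p)) - t / p"

definition bin_nu :: "real \<Rightarrow> nat \<Rightarrow> int" where
  "bin_nu p N = \<lceil>real N * p\<rceil>"

definition bin_h :: "real \<Rightarrow> nat \<Rightarrow> real" where
  "bin_h p N = of_int (bin_nu p N) - real N * p"

end

theory Submission
  imports Defs "HOL-Real_Asymp.Real_Asymp"
begin

text \<open>
  With $k = Np + t$ the logarithm of the binomial probability is a combination of $\ln N!$,
  $\ln k!$ and $\ln (N-k)!$, whose arguments are $M + s$ for $M = N, Np, Nq$ and bounded
  $s = 0, t, -t$. Stirling's formula with its first correction term, expanded at such a shifted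
  argument up to $O(M^{-2})$, therefore gives
  $\sqrt{2\pi Npq}\,\Pr\{X = k\} = 1 + A_1(t;p)/N + O(N^{-2})$, uniformly for bounded $t$.
  Apply this to $t = h + r$ and sum over the finitely many $r$. Stirling's formula itself comes
  from squeezing the remainder $s_n$ between the monotone sequences $s_n \pm 1/n^2$, and its
  constant from the Wallis product.
\<close>

section \<open>Stirling's formula with its first correction term and error O(n^(-2))\<close>

definition stirling_rem :: "nat \<Rightarrow> real" where
  "stirling_rem n = ln (fact n) - ((real n + 1/2) * ln (real n) - real n + 1 / (12 * real n))"

text \<open>The factorials cancel in the difference, which leaves an elementary function of n open
  to asymptotic expansion.\<close>

lemma stirling_rem_diff:
  assumes "n \<ge> 1"
  shows "stirling_rem n - stirling_rem (Suc n) =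
    (real n + 1/2) * ln (real (Suc n) / real n) - 1 - 1 / (12 * real n) + 1 / (12 * real (Suc n))"
proof -
  have 1: "ln (fact (Suc n) :: real) = ln (real (Suc n)) + ln (fact n)"
    by (subst fact_Suc) (simp add: ln_mult)
  have 2: "ln (real (Suc n) / real n) = ln (real (Suc n)) - ln (real n)"
    using assms by (simp add: ln_div)
  show ?thesis
    unfolding stirling_rem_def 1 2 by (simp add: algebra_simps)
qed

text \<open>The correction 1/(12n) makes the increments of order n^(-4), so they are eventually
  dominated by the decrements of 1/n^2, which are of order n^(-3). The squeeze then yields the limit
  together with the rate.\<close>

lemma stirling_rem_convergent:
  "\<exists>c. stirling_rem \<longlonglongrightarrow> c \<and> (\<forall>\<^sub>F n in sequentially. \<bar>stirling_rem n - c\<bar> \<le> 1 / (real n)\<^sup>2)"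
proof -
  have "\<forall>\<^sub>F n in sequentially.
      \<bar>(real n + 1/2) * ln (real (Suc n) / real n) - 1 - 1 / (12 * real n) + 1 / (12 * real (Suc n))\<bar>
        \<le> 1 / (real n)\<^sup>2 - 1 / (real (Suc n))\<^sup>2"
    by real_asymp
  then have "\<forall>\<^sub>F n in sequentially.
      \<bar>stirling_rem n - stirling_rem (Suc n)\<bar> \<le> 1 / (real n)\<^sup>2 - 1 / (real (Suc n))\<^sup>2"
    using eventually_ge_at_top[of 1] by eventually_elim (simp only: stirling_rem_diff)
  then obtain n0 where n0: "\<And>n. n \<ge> n0 \<Longrightarrow>
      \<bar>stirling_rem n - stirling_rem (Suc n)\<bar> \<le> 1 / (real n)\<^sup>2 - 1 / (real (Suc n))\<^sup>2"
    by (auto simp: eventually_sequentially)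
  \<comment> \<open>The shift by \<open>n0\<close> makes monotonicity hold from index 0 on, as the
    nested-sequence criterion demands. The midpoint of \<open>f\<close> and \<open>g\<close> is the
    remainder itself.\<close>
  define f g where "f = (\<lambda>n. stirling_rem (n + n0) - 1 / (real (n + n0))\<^sup>2)"
    and "g = (\<lambda>n. stirling_rem (n + n0) + 1 / (real (n + n0))\<^sup>2)"
  have "\<exists>l. ((\<forall>n. f n \<le> l) \<and> f \<longlonglongrightarrow> l) \<and> ((\<forall>n. l \<le> g n) \<and> g \<longlonglongrightarrow> l)"
  proof (rule nested_sequence_unique)
    have "f n \<le> f (Suc n)" "g (Suc n) \<le> g n" for n
      using n0[of "n + n0"] by (simp_all add: f_def g_def abs_le_iff algebra_simps)
    then show "\<forall>n. f n \<le> f (Suc n)" "\<forall>n. g (Suc n) \<le> g n"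
      by blast+
    show "\<forall>n. f n \<le> g n"
    proof
      fix n
      have "0 \<le> 1 / (real (n + n0))\<^sup>2" by simp
      then show "f n \<le> g n" unfolding f_def g_def by linarith
    qed
    have "(\<lambda>n. - 2 / (real (n + n0))\<^sup>2) \<longlonglongrightarrow> 0" by real_asymp
    then show "(\<lambda>n. f n - g n) \<longlonglongrightarrow> 0" by (simp add: f_def g_def)
  qed
  then obtain l where l: "\<And>n. f n \<le> l" "f \<longlonglongrightarrow> l" "\<And>n. l \<le> g n" "g \<longlonglongrightarrow> l"
    by blast
  have "(\<lambda>n. (f n + g n) / 2) \<longlonglongrightarrow> (l + l) / 2"
    by (intro tendsto_intros l) simp
  then have "(\<lambda>n. stirling_rem (n + n0)) \<longlonglongrightarrow> l"
    by (simp add: f_def g_def)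
  then have lim: "stirling_rem \<longlonglongrightarrow> l"
    by (rule LIMSEQ_offset)
  have "\<bar>stirling_rem n - l\<bar> \<le> 1 / (real n)\<^sup>2" if "n \<ge> n0" for n
    using l(1,3)[of "n - n0"] that unfolding f_def g_def by (simp add: abs_le_iff)
  then show ?thesis
    using lim by (auto simp: eventually_sequentially)
qed

text \<open>Each factor is (2k)^2 / ((2k-1)(2k+1)), and the product of the odd numbers below 2n is
  (2n)! / (2^n n!). In this form Stirling's formula can be inserted into the Wallis product.\<close>

lemma wallis_product_fact:
  "(\<Prod>k=1..n. (4 * (real k)\<^sup>2) / (4 * (real k)\<^sup>2 - 1)) =
     2 ^ (4 * n) * (fact n) ^ 4 / ((fact (2 * n))\<^sup>2 * (2 * real n + 1))"
proof (induction n)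
  case (Suc n)
  have f: "fact (2 * Suc n) = (2 * (real n + 1)) * (2 * real n + 1) * fact (2 * n)"
    by (simp add: algebra_simps)
  have g: "fact (Suc n) = (real n + 1) * fact n"
    by (simp add: algebra_simps)
  have d: "4 * (real (Suc n))\<^sup>2 - 1 = (2 * real n + 1) * (2 * real n + 3)"
    by (simp add: power2_eq_square algebra_simps)
  have nz: "2 * real n + 1 \<noteq> 0" "2 * real n + 3 \<noteq> 0" "real n + 1 \<noteq> 0"
    by linarith+
  have "(\<Prod>k=1..Suc n. (4 * (real k)\<^sup>2) / (4 * (real k)\<^sup>2 - 1)) =
     2 ^ (4 * n) * (fact n) ^ 4 / ((fact (2 * n))\<^sup>2 * (2 * real n + 1)) *
     (4 * (real n + 1)\<^sup>2 / ((2 * real n + 1) * (2 * real n + 3)))"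
    by (subst prod.cl_ivl_Suc, subst Suc.IH, subst d) (simp add: add.commute)
  also have "\<dots> = 2 ^ (4 * n) * 16 * ((real n + 1) * fact n) ^ 4 /
      (((2 * (real n + 1)) * (2 * real n + 1) * fact (2 * n))\<^sup>2 * (2 * real n + 3))"
    using nz by (simp add: divide_simps power2_eq_square power4_eq_xxxx) (simp add: algebra_simps)
  also have "\<dots> = 2 ^ (4 * Suc n) * (fact (Suc n)) ^ 4 /
      ((fact (2 * Suc n))\<^sup>2 * (2 * real (Suc n) + 1))"
    unfolding f g by (simp add: power_add add.commute)
  finally show ?case .
qed simp

lemma stirling_rem_tendsto: "stirling_rem \<longlonglongrightarrow> ln (2 * pi) / 2"
proof -
  obtain c where c: "stirling_rem \<longlonglongrightarrow> c"
    using stirling_rem_convergent by blast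
  \<comment> \<open>\<open>h\<close> is the elementary part of the logarithm of the closed form once
    each ln m! is replaced by \<open>stirling_rem m\<close> plus its explicit terms; 24n is 12 *
    (2n).\<close>
  define h where "h = (\<lambda>n. 4 * ((real n + 1/2) * ln (real n) - real n + 1 / (12 * real n))
     - 2 * ((2 * real n + 1/2) * ln (2 * real n) - 2 * real n + 1 / (24 * real n))
     + 4 * real n * ln 2 - ln (2 * real n + 1))"
  have h: "h \<longlonglongrightarrow> - (2 * ln 2)"
    unfolding h_def by real_asymp
  have "(\<lambda>n. stirling_rem (2 * n)) \<longlonglongrightarrow> c"
    using LIMSEQ_subseq_LIMSEQ[OF c, of "(*) 2"] by (simp add: strict_mono_def o_def)
  then have "(\<lambda>n. 4 * stirling_rem n - 2 * stirling_rem (2 * n) + h n) \<longlonglongrightarrow> 4 * c - 2 * c + - (2 * ln 2)"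
    by (intro tendsto_intros c h)
  moreover have "\<forall>\<^sub>F n in sequentially. 4 * stirling_rem n - 2 * stirling_rem (2 * n) + h n =
      ln (\<Prod>k=1..n. (4 * (real k)\<^sup>2) / (4 * (real k)\<^sup>2 - 1))"
    using eventually_ge_at_top[of 1]
  proof eventually_elim
    case (elim n)
    have pos: "0 < 2 * real n + 1" by linarith
    have "ln (2 ^ (4 * n) * (fact n) ^ 4 / ((fact (2 * n))\<^sup>2 * (2 * real n + 1))) =
        4 * real n * ln 2 + 4 * ln (fact n) - 2 * ln (fact (2 * n)) - ln (2 * real n + 1)"
      using pos by (simp add: ln_mult ln_div ln_realpow)
    then show ?case
      unfolding wallis_product_fact stirling_rem_def h_def by simp
  qed
  ultimately have "(\<lambda>n. ln (\<Prod>k=1..n. (4 * (real k)\<^sup>2) / (4 * (real k)\<^sup>2 - 1))) \<longlonglongrightarrow> 4 * c - 2 * c + - (2 * ln 2)"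
    by (rule Lim_transform_eventually)
  moreover have "(\<lambda>n. ln (\<Prod>k=1..n. (4 * (real k)\<^sup>2) / (4 * (real k)\<^sup>2 - 1))) \<longlonglongrightarrow> ln (pi / 2)"
    by (intro tendsto_ln wallis) simp
  \<comment> \<open>Both limits of the logarithm of the Wallis product agree, so 2c = ln(pi/2) + 2
    ln 2 = ln(2 pi).\<close>
  ultimately have "4 * c - 2 * c + - (2 * ln 2) = ln (pi / 2)"
    by (rule LIMSEQ_unique)
  moreover have "ln (2 * pi) = ln (pi / 2) + 2 * ln 2"
    by (simp add: ln_mult ln_div)
  ultimately have "c = ln (2 * pi) / 2"
    by linarith
  with c show ?thesis
    by (simp only:)
qed

lemma stirling_rem_bigo:
  "(\<lambda>n. stirling_rem n - ln (2 * pi) / 2) \<in> O(\<lambda>n. 1 / (real n)\<^sup>2)"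
proof -
  obtain c where c: "stirling_rem \<longlonglongrightarrow> c"
    and ev: "\<forall>\<^sub>F n in sequentially. \<bar>stirling_rem n - c\<bar> \<le> 1 / (real n)\<^sup>2"
    using stirling_rem_convergent by blast
  have "c = ln (2 * pi) / 2"
    using c stirling_rem_tendsto by (rule LIMSEQ_unique)
  with ev show ?thesis
    by (intro bigoI[of _ 1]) simp
qed

section \<open>Expansion of a single binomial probability, beginning with tools for Landau
  symbols\<close>

lemma bigo_eventually_eq:
  assumes "f \<in> O[F](h)" "\<forall>\<^sub>F x in F. f x = g x"
  shows "g \<in> O[F](h)"
  using landau_o.big.in_cong[OF assms(2)] assms(1) by simp

lemma tendsto_0_bigo:
  fixes f g :: "'a \<Rightarrow> real"
  assumes "(g \<longlongrightarrow> 0) F" "f \<in> O[F](g)"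
  shows "(f \<longlongrightarrow> 0) F"
proof -
  obtain c where "\<forall>\<^sub>F x in F. norm (f x) \<le> c * norm (g x)"
    using assms(2) by (elim landau_o.bigE)
  then show ?thesis
    by (intro tendsto_0_le[OF assms(1), of _ c]) (simp add: mult.commute)
qed

text \<open>The Taylor bounds below are composed with functions that tend to 0 but may take the
  value 0, so a bound on the punctured neighbourhood is not enough.\<close>

lemma bigo_at_imp_nhds:
  fixes f g :: "'a::topological_space \<Rightarrow> real"
  assumes "f \<in> O[at a](g)" "f a = 0"
  shows "f \<in> O[nhds a](g)"
proof -
  obtain c where "\<forall>\<^sub>F x in at a. norm (f x) \<le> c * norm (g x)" "c > 0"
    using assms(1) by (elim landau_o.bigE)
  then show ?thesis
    using assms(2) by (intro bigoI[of _ c]) (simp add: eventually_nhds_conv_at)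
qed

lemma ln_taylor2_bigo: "(\<lambda>x::real. ln (1 + x) - (x - x\<^sup>2 / 2)) \<in> O[nhds 0](\<lambda>x. x ^ 3)"
proof (rule bigo_at_imp_nhds)
  show "(\<lambda>x::real. ln (1 + x) - (x - x\<^sup>2 / 2)) \<in> O[at 0](\<lambda>x. x ^ 3)" by real_asymp
qed simp

lemma exp_taylor1_bigo: "(\<lambda>x::real. exp x - (1 + x)) \<in> O[nhds 0](\<lambda>x. x\<^sup>2)"
proof (rule bigo_at_imp_nhds)
  show "(\<lambda>x::real. exp x - (1 + x)) \<in> O[at 0](\<lambda>x. x\<^sup>2)" by real_asymp
qed simp

text \<open>Write ln k = ln M + ln(1 + t/M) in Stirling's formula. The product (M+t+1/2)(t/M -
  t^2/(2M^2)) equals t + (t^2+t)/(2M) up to O(M^(-2)), and 1/(12k) may be replaced by 1/(12M) at the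
  same cost.\<close>

lemma ln_fact_shifted_bigo:
  fixes M t :: "'a \<Rightarrow> real" and k :: "'a \<Rightarrow> nat"
  assumes M: "filterlim M at_top F" and t: "t \<in> O[F](\<lambda>_. 1)"
    and k: "\<forall>\<^sub>F x in F. real (k x) = M x + t x"
  shows "(\<lambda>x. ln (fact (k x)) - ((M x + t x + 1/2) * ln (M x) - M x
            + (((t x)\<^sup>2 + t x) / 2 + 1/12) / M x + ln (2 * pi) / 2)) \<in> O[F](\<lambda>x. 1 / (M x)\<^sup>2)"
proof -
  obtain T where T: "\<forall>\<^sub>F x in F. \<bar>t x\<bar> \<le> T" "T > 0"
    using t by (elim landau_o.bigE) simp
  have Mbig: "\<forall>\<^sub>F x in F. M x \<ge> c" for c
    using M by (simp add: filterlim_at_top)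
  \<comment> \<open>Once M \<ge> 2T, a shift of size at most T removes at most half of M. This gives
    both k \<rightarrow> \<infinity> and 1/k = O(1/M).\<close>
  have half: "\<forall>\<^sub>F x in F. M x / 2 \<le> real (k x) \<and> M x > 0"
    using k T(1) Mbig[of "2 * T"] by eventually_elim (use T(2) in auto)
  have k_lim: "filterlim k sequentially F"
  proof -
    have "filterlim (\<lambda>x. real (k x)) at_top F"
      unfolding filterlim_at_top
    proof
      fix Z show "\<forall>\<^sub>F x in F. Z \<le> real (k x)"
        using half Mbig[of "2 * Z"] by eventually_elim auto
    qed
    then show ?thesis by (simp add: filterlim_sequentially_iff_filterlim_real)
  qed
  define u where "u = (\<lambda>x. t x / M x)"
  \<comment> \<open>The Taylor remainder is O(M^(-3)); its factor M + t + 1/2 costs one power of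
    M.\<close>
  define \<rho> where "\<rho> = (\<lambda>x. ln (1 + u x) - (u x - (u x)\<^sup>2 / 2))"
  have one: "(\<lambda>_. 1) \<in> O[F](M)"
    using Mbig[of 1] by (intro bigoI[of _ 1]) (auto elim: eventually_mono)
  have tM: "t \<in> O[F](M)"
    using t one by (rule landau_o.big_trans)
  have uO: "u \<in> O[F](\<lambda>x. 1 / M x)"
    using landau_o.big.mult[OF t, of "\<lambda>x. 1 / M x" "\<lambda>x. 1 / M x"] by (simp add: u_def)
  have "((\<lambda>x. 1 / M x) \<longlongrightarrow> 0) F"
    using tendsto_inverse_0_at_top[OF M] by (simp add: inverse_eq_divide)
  then have u0: "(u \<longlongrightarrow> 0) F"
    by (rule tendsto_0_bigo) (rule uO)
  have "\<rho> \<in> O[F](\<lambda>x. (u x) ^ 3)"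
    using landau_o.big.compose[OF ln_taylor2_bigo u0] by (simp add: \<rho>_def)
  also have "(\<lambda>x. (u x) ^ 3) \<in> O[F](\<lambda>x. (1 / M x) ^ 3)"
    by (intro landau_o.big_power uO)
  finally have \<rho>O: "\<rho> \<in> O[F](\<lambda>x. (1 / M x) ^ 3)" .
  have "(\<lambda>x. M x + t x + 1/2) \<in> O[F](M)"
    using tM one by (intro sum_in_bigo) (auto intro: landau_o.big.mult_in_1)
  from landau_o.big.mult[OF this \<rho>O]
  have "(\<lambda>x. (M x + t x + 1/2) * \<rho> x) \<in> O[F](\<lambda>x. M x * (1 / M x) ^ 3)" .
  also have "(\<lambda>x. M x * (1 / M x) ^ 3) \<in> O[F](\<lambda>x. 1 / (M x)\<^sup>2)"
    using half by (intro bigoI[of _ 1]) (auto elim!: eventually_mono simp: power_numeral_reduce field_simps)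
  finally have r1: "(\<lambda>x. (M x + t x + 1/2) * \<rho> x) \<in> O[F](\<lambda>x. 1 / (M x)\<^sup>2)" .
  have "(\<lambda>x. (t x + 1/2) * (t x)\<^sup>2 / 2) \<in> O[F](\<lambda>_. 1)"
  proof -
    have "(\<lambda>x. t x + 1/2) \<in> O[F](\<lambda>_. 1)"
      using t by (intro sum_in_bigo) simp_all
    moreover have "(\<lambda>x. (t x)\<^sup>2) \<in> O[F](\<lambda>_. 1)"
      using landau_o.big_power[OF t, of 2] by simp
    ultimately have "(\<lambda>x. (t x + 1/2) * (t x)\<^sup>2) \<in> O[F](\<lambda>_. 1)"
      using landau_o.big.mult by fastforce
    then show ?thesis by simp
  qed
  from landau_o.big.mult[OF this, of "\<lambda>x. 1 / (M x)\<^sup>2" "\<lambda>x. 1 / (M x)\<^sup>2"]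
  have r2: "(\<lambda>x. (t x + 1/2) * (t x)\<^sup>2 / 2 * (1 / (M x)\<^sup>2)) \<in> O[F](\<lambda>x. 1 / (M x)\<^sup>2)"
    by simp
  have kinv: "(\<lambda>x. 1 / real (k x)) \<in> O[F](\<lambda>x. 1 / M x)"
    using half by (intro bigoI[of _ 2]) (auto elim!: eventually_mono simp: field_simps)
  have r3: "(\<lambda>x. t x * (1 / (12 * M x) * (1 / real (k x)))) \<in> O[F](\<lambda>x. 1 / (M x)\<^sup>2)"
  proof -
    have "(\<lambda>x. 1 / (12 * M x)) \<in> O[F](\<lambda>x. 1 / M x)"
      by (intro bigoI[of _ "1/12"] always_eventually) (simp add: abs_mult)
    from landau_o.big.mult[OF t landau_o.big.mult[OF this kinv]]
    show ?thesis by (simp add: power2_eq_square)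
  qed
  have r4: "(\<lambda>x. stirling_rem (k x) - ln (2 * pi) / 2) \<in> O[F](\<lambda>x. 1 / (M x)\<^sup>2)"
  proof -
    have "(\<lambda>x. stirling_rem (k x) - ln (2 * pi) / 2) \<in> O[F](\<lambda>x. 1 / (real (k x))\<^sup>2)"
      using landau_o.big.compose[OF stirling_rem_bigo k_lim] .
    also have "(\<lambda>x. 1 / (real (k x))\<^sup>2) \<in> O[F](\<lambda>x. 1 / (M x)\<^sup>2)"
      using landau_o.big_power[OF kinv, of 2] by (simp add: power_divide)
    finally show ?thesis .
  qed
  \<comment> \<open>These four terms are exactly the total error: Stirling remainder, Taylor
    remainder, the M^(-2) part of the product, and the change from 1/(12k) to 1/(12M).\<close>
  have "(\<lambda>x. (stirling_rem (k x) - ln (2 * pi) / 2) + (M x + t x + 1/2) * \<rho> x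
        - (t x + 1/2) * (t x)\<^sup>2 / 2 * (1 / (M x)\<^sup>2) - t x * (1 / (12 * M x) * (1 / real (k x))))
        \<in> O[F](\<lambda>x. 1 / (M x)\<^sup>2)"
    by (intro sum_in_bigo r1 r2 r3 r4)
  moreover have "\<forall>\<^sub>F x in F. (stirling_rem (k x) - ln (2 * pi) / 2) + (M x + t x + 1/2) * \<rho> x
        - (t x + 1/2) * (t x)\<^sup>2 / 2 * (1 / (M x)\<^sup>2) - t x * (1 / (12 * M x) * (1 / real (k x))) =
      ln (fact (k x)) - ((M x + t x + 1/2) * ln (M x) - M x
            + (((t x)\<^sup>2 + t x) / 2 + 1/12) / M x + ln (2 * pi) / 2)"
    using k half
  proof eventually_elim
    case (elim x)
    then have pos: "M x > 0" "M x + t x > 0" by auto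
    have "1 + u x = (M x + t x) / M x"
      using pos by (simp add: u_def field_simps)
    then have "ln (1 + u x) = ln (M x + t x) - ln (M x)"
      using pos by (simp add: ln_div)
    then have 1: "\<rho> x = ln (M x + t x) - ln (M x) - (t x / M x - (t x / M x)\<^sup>2 / 2)"
      by (simp add: \<rho>_def u_def)
    have 2: "(M x + t x + 1/2) * (t x / M x - (t x / M x)\<^sup>2 / 2) =
        t x + ((t x)\<^sup>2 + t x) / 2 / M x - (t x + 1/2) * (t x)\<^sup>2 / 2 * (1 / (M x)\<^sup>2)"
      using pos by (simp add: field_simps power2_eq_square)
    have 3: "1 / (12 * (M x + t x)) + t x * (1 / (12 * M x) * (1 / (M x + t x))) = 1 / (12 * M x)"
    proof -
      have "1 / (12 * z) + (z - M x) * (1 / (12 * M x) * (1 / z)) = 1 / (12 * M x)" if "z > 0" for z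
        using pos that by (simp add: field_simps)
      from this[OF pos(2)] show ?thesis by simp
    qed
    have 4: "stirling_rem (k x) = ln (fact (k x))
        - ((M x + t x + 1/2) * ln (M x + t x) - (M x + t x) + 1 / (12 * (M x + t x)))"
      using elim by (simp add: stirling_rem_def)
    have 5: "(((t x)\<^sup>2 + t x) / 2 + 1/12) / M x = ((t x)\<^sup>2 + t x) / 2 / M x + 1 / (12 * M x)"
      by (simp add: add_divide_distrib)
    show ?case
      unfolding 4 5 1 right_diff_distrib[of _ "ln (M x + t x) - ln (M x)"] 2 using 3 elim
      by (simp add: algebra_simps)
  qed
  ultimately show ?thesis
    by (rule bigo_eventually_eq) 
qed

text \<open>The shifted Stirling expansion is used at (N, 0), (Np, t) and (Nq, -t). In the logarithm
  of the normalized probability everything cancels down to A1/N + O(N^(-2)), and exponentiating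
  preserves this order.\<close>

lemma binomial_pmf_local_bigo:
  fixes t :: "nat \<Rightarrow> real" and k :: "nat \<Rightarrow> nat"
  assumes p: "0 < p" "p < 1" and q: "q = 1 - p" and t: "t \<in> O(\<lambda>_. 1)"
    and k: "\<forall>\<^sub>F N in sequentially. real (k N) = real N * p + t N"
  shows "(\<lambda>N. sqrt (2 * pi * real N * p * q) * pmf (binomial_pmf N p) (k N)
            - (1 + A1 (t N) p / real N)) \<in> O(\<lambda>N. 1 / (real N)\<^sup>2)"
proof -
  have q0: "q > 0" using p q by simp
  define S where "S = (\<lambda>(M::real) t. (M + t + 1/2) * ln M - M + ((t\<^sup>2 + t) / 2 + 1/12) / M + ln (2 * pi) / 2)"
  have limN: "filterlim (\<lambda>N. real N) at_top sequentially"
    by (rule filterlim_real_sequentially)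
  have limp: "filterlim (\<lambda>N. real N * p) at_top sequentially"
    and limq: "filterlim (\<lambda>N. real N * q) at_top sequentially"
    using p q0 by real_asymp+
  obtain T where T: "\<forall>\<^sub>F N in sequentially. \<bar>t N\<bar> \<le> T"
    using t by (elim landau_o.bigE) simp
  \<comment> \<open>This keeps the natural-number subtraction \<open>N - k N\<close> from
    truncating; it holds once Nq exceeds the bound on t.\<close>
  have kle: "\<forall>\<^sub>F N in sequentially. k N \<le> N"
  proof -
    have "\<forall>\<^sub>F N in sequentially. T \<le> real N * q"
      using limq by (simp add: filterlim_at_top)
    with k T show ?thesis
    proof eventually_elim
      case (elim N)
      then have "real (k N) \<le> real N * p + real N * q" by linarith
      then show ?case by (simp add: q algebra_simps)
    qed
  qed
  have scale: "(\<lambda>N. 1 / (real N * c)\<^sup>2) \<in> O(\<lambda>N. 1 / (real N)\<^sup>2)" if "c > 0" for c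
    using that by real_asymp
  have e0: "(\<lambda>N. ln (fact N) - S (real N) 0) \<in> O(\<lambda>N. 1 / (real N)\<^sup>2)"
    using ln_fact_shifted_bigo[OF limN, of "\<lambda>_. 0" "\<lambda>N. N"] by (simp add: S_def)
  have "(\<lambda>N. ln (fact (k N)) - S (real N * p) (t N)) \<in> O(\<lambda>N. 1 / (real N * p)\<^sup>2)"
    using ln_fact_shifted_bigo[OF limp t k] by (simp add: S_def)
  from landau_o.big_trans[OF this scale]
  have e1: "(\<lambda>N. ln (fact (k N)) - S (real N * p) (t N)) \<in> O(\<lambda>N. 1 / (real N)\<^sup>2)"
    using p by simp
  have "\<forall>\<^sub>F N in sequentially. real (N - k N) = real N * q + - t N"
    using k kle by eventually_elim (simp add: q algebra_simps)
  from ln_fact_shifted_bigo[OF limq _ this] t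
  have "(\<lambda>N. ln (fact (N - k N)) - S (real N * q) (- t N)) \<in> O(\<lambda>N. 1 / (real N * q)\<^sup>2)"
    by (simp add: S_def)
  from landau_o.big_trans[OF this scale]
  have e2: "(\<lambda>N. ln (fact (N - k N)) - S (real N * q) (- t N)) \<in> O(\<lambda>N. 1 / (real N)\<^sup>2)"
    using q0 by simp
  \<comment> \<open>\<open>y N\<close> is the logarithm of sqrt(2 pi N p q) times the probability of
    \<open>k N\<close>, and \<open>a N\<close> is its predicted leading term.\<close>
  define y where "y = (\<lambda>N. ln (fact N) - ln (fact (k N)) - ln (fact (N - k N)) + real (k N) * ln p
     + real (N - k N) * ln q + ln (2 * pi * real N * p * q) / 2)"
  define a where "a = (\<lambda>N. A1 (t N) p / real N)"
  have ya: "(\<lambda>N. y N - a N) \<in> O(\<lambda>N. 1 / (real N)\<^sup>2)"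
  proof -
    have "(\<lambda>N. (ln (fact N) - S (real N) 0) - (ln (fact (k N)) - S (real N * p) (t N))
        - (ln (fact (N - k N)) - S (real N * q) (- t N))) \<in> O(\<lambda>N. 1 / (real N)\<^sup>2)"
      by (intro sum_in_bigo e0 e1 e2)
    moreover have "\<forall>\<^sub>F N in sequentially. (ln (fact N) - S (real N) 0)
        - (ln (fact (k N)) - S (real N * p) (t N))
        - (ln (fact (N - k N)) - S (real N * q) (- t N)) = y N - a N"
      using k kle eventually_ge_at_top[of 1]
    proof eventually_elim
      case (elim N)
      have N: "real N > 0" using elim by simp
      have l: "ln (real N * p) = ln (real N) + ln p" "ln (real N * q) = ln (real N) + ln q"
        "ln (2 * pi * real N * p * q) = ln (2 * pi) + ln (real N) + ln p + ln q"
        using N p q0 by (simp_all add: ln_mult)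
      have kk: "real (N - k N) = real N * q - t N"
        using elim by (simp add: q algebra_simps)
      \<comment> \<open>Here \<open>A1\<close> emerges from the three 1/M corrections: 1/p + 1/q =
        1/(pq), and t(q-p)/(2pq) = t/p - t/(2pq) because q - p = 2q - 1.\<close>
      have a_eq: "a N = 1/12 / real N - (((t N)\<^sup>2 + t N) / 2 + 1/12) / (real N * p)
           - (((- t N)\<^sup>2 + - t N) / 2 + 1/12) / (real N * q)"
        unfolding a_def A1_def bernpoly2_def q using N p
        by (simp add: field_simps power2_eq_square)
      have 1: "real N = real N * p + real N * q"
        by (simp add: q algebra_simps)
      then have "real N * ln (real N) = real N * p * ln (real N) + real N * q * ln (real N)"
        by (metis distrib_right)
      with 1 show ?case
        unfolding S_def y_def a_eq l kk using elim
        by (simp add: algebra_simps add_divide_distrib)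
    qed
    ultimately show ?thesis
      by (rule bigo_eventually_eq)
  qed
  have aO: "a \<in> O(\<lambda>N. 1 / real N)"
  proof -
    have "(\<lambda>N. A1 (t N) p) \<in> O(\<lambda>_. 1)"
    proof -
      have "(\<lambda>N. (t N)\<^sup>2) \<in> O(\<lambda>_. 1)"
        using landau_o.big_power[OF t, of 2] by simp
      then show ?thesis
        unfolding A1_def bernpoly2_def using t p by (intro sum_in_bigo landau_o.big.cdiv_in_iff'[THEN iffD2]) auto
    qed
    from landau_o.big.mult[OF this, of "\<lambda>N. 1 / real N" "\<lambda>N. 1 / real N"]
    show ?thesis by (simp add: a_def)
  qed
  have sq: "(\<lambda>N. 1 / (real N)\<^sup>2) \<in> O(\<lambda>N. 1 / real N)"
    by real_asymp
  have yO: "y \<in> O(\<lambda>N. 1 / real N)"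
    using sum_in_bigo(1)[OF landau_o.big_trans[OF ya sq] aO] by simp
  have "(\<lambda>N. 1 / real N) \<longlonglongrightarrow> 0" by real_asymp
  then have y0: "y \<longlonglongrightarrow> 0"
    by (rule tendsto_0_bigo) (rule yO)
  \<comment> \<open>Since y = O(1/N), the quadratic error of exp y = 1 + y is O(N^(-2)).\<close>
  have "(\<lambda>N. exp (y N) - (1 + y N)) \<in> O(\<lambda>N. (y N)\<^sup>2)"
    using landau_o.big.compose[OF exp_taylor1_bigo y0] .
  also have "(\<lambda>N. (y N)\<^sup>2) \<in> O(\<lambda>N. 1 / (real N)\<^sup>2)"
    using landau_o.big_power[OF yO, of 2] by (simp add: power_divide)
  finally have "(\<lambda>N. exp (y N) - (1 + y N)) \<in> O(\<lambda>N. 1 / (real N)\<^sup>2)" .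
  from sum_in_bigo(1)[OF this ya]
  have "(\<lambda>N. exp (y N) - (1 + a N)) \<in> O(\<lambda>N. 1 / (real N)\<^sup>2)"
    by (simp add: algebra_simps)
  moreover have "\<forall>\<^sub>F N in sequentially. exp (y N) - (1 + a N) =
      sqrt (2 * pi * real N * p * q) * pmf (binomial_pmf N p) (k N) - (1 + A1 (t N) p / real N)"
    using kle eventually_ge_at_top[of 1]
  proof eventually_elim
    case (elim N)
    define Q where "Q = 2 * pi * real N * p * q"
    have Q: "Q > 0" using elim p q0 by (simp add: Q_def)
    have "exp (ln Q / 2) = sqrt Q"
      using Q by (simp add: ln_sqrt[symmetric])
    moreover have "exp (real (k N) * ln p) = p ^ k N" "exp (real (N - k N) * ln q) = q ^ (N - k N)"
      using p q0 by (simp_all add: exp_of_nat_mult)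
    ultimately have "exp (y N) = fact N / fact (k N) / fact (N - k N) * p ^ k N * q ^ (N - k N) * sqrt Q"
      unfolding y_def Q_def[symmetric] by (simp add: exp_add exp_diff)
    moreover have "pmf (binomial_pmf N p) (k N) = fact N / fact (k N) / fact (N - k N) * p ^ k N * q ^ (N - k N)"
      using p elim by (simp add: q binomial_fact)
    ultimately show ?case
      by (simp add: a_def Q_def)
  qed
  ultimately show ?thesis
    by (rule bigo_eventually_eq)
qed

section \<open>Summation over the window around the mean\<close>

lemma sum_A1_shift:
  assumes "0 < p" "p < 1" "q = 1 - p"
  shows "(\<Sum>r = - int R..int R. A1 (h + of_int r) p) =
    real (2 * R + 1) * (1 / 12 - bernpoly2 h / (2 * p * q) - h / p)
      - real (R * (R + 1) * (2 * R + 1)) / (6 * p * q)"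
proof (induction R)
  case 0
  show ?case by (simp add: A1_def assms)
next
  case (Suc R)
  have nz: "p \<noteq> 0" "q \<noteq> 0"
    using assms by simp_all
  have "{- int (Suc R)..int (Suc R)} = insert (- int (Suc R)) (insert (int (Suc R)) {- int R..int R})"
    by auto
  then have "(\<Sum>r = - int (Suc R)..int (Suc R). A1 (h + of_int r) p) =
      A1 (h + - (1 + real R)) p + A1 (h + (1 + real R)) p + (\<Sum>r = - int R..int R. A1 (h + of_int r) p)"
    by (simp add: algebra_simps)
  \<comment> \<open>In the pair of shifts by R+1 and -(R+1) the linear terms cancel, and the second
    Bernoulli polynomial contributes 2(R+1)^2 beyond twice its value at h. The closed form thus
    rests on the sum of squares.\<close>
  also have "A1 (h + - (1 + real R)) p + A1 (h + (1 + real R)) p =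
      2 * (1 / 12 - bernpoly2 h / (2 * p * q) - h / p) - (real R + 1)\<^sup>2 / (p * q)"
    unfolding A1_def bernpoly2_def assms(3)[symmetric] using nz
    by (simp add: field_simps power2_eq_square)
  also note Suc.IH
  also have "2 * C - (real R + 1)\<^sup>2 / (p * q) +
      (real (2 * R + 1) * C - real (R * (R + 1) * (2 * R + 1)) / (6 * p * q)) =
      real (2 * Suc R + 1) * C - real (Suc R * (Suc R + 1) * (2 * Suc R + 1)) / (6 * p * q)" for C
    using nz by (simp add: field_simps power2_eq_square)
  finally show ?case .
qed

theorem corollary5p5:
  fixes R :: nat and p q :: real
  assumes "0 < p" and "p < 1" and "q = 1 - p"
  shows "(\<exists>E :: nat \<Rightarrow> real. E \<in> O(\<lambda>N. 1 / (real N)\<^sup>2) \<and>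
            (\<forall>N\<ge>1. measure_pmf.prob (binomial_pmf N p) {X. \<bar>int X - bin_nu p N\<bar> \<le> int R}
               = 1 / sqrt (2 * pi * real N * p * q) *
                   (real (2 * R + 1)
                    + 1 / real N * (\<Sum>r = - int R..int R. A1 (bin_h p N + of_int r) p)
                    + E N)))
       \<and> (\<forall>N. (\<Sum>r = - int R..int R. A1 (bin_h p N + of_int r) p)
               = real (2 * R + 1) *
                   (1 / 12 - bernpoly2 (bin_h p N) / (2 * p * q) - bin_h p N / p)
                 - real (R * (R + 1) * (2 * R + 1)) / (6 * p * q))"
proof (intro conjI allI)
  fix N
  show "(\<Sum>r = - int R..int R. A1 (bin_h p N + of_int r) p) =
      real (2 * R + 1) * (1 / 12 - bernpoly2 (bin_h p N) / (2 * p * q) - bin_h p N / p)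
        - real (R * (R + 1) * (2 * R + 1)) / (6 * p * q)"
    by (rule sum_A1_shift[OF assms])
next
  define P where "P = (\<lambda>N. measure_pmf.prob (binomial_pmf N p) {X. \<bar>int X - bin_nu p N\<bar> \<le> int R})"
  define s where "s = (\<lambda>N. sqrt (2 * pi * real N * p * q))"
  \<comment> \<open>\<open>E\<close> is obtained by solving the claimed formula for the error, so
    the identity is immediate where \<open>s N\<close> > 0 and only the growth bound needs
    work.\<close>
  define E where "E = (\<lambda>N. s N * P N - real (2 * R + 1)
      - 1 / real N * (\<Sum>r = - int R..int R. A1 (bin_h p N + of_int r) p))"
  define k where "k = (\<lambda>r N. nat (bin_nu p N + r))"
  \<comment> \<open>Once Np \<ge> R the whole window is nonnegative, so \<open>nat\<close> in
    \<open>k\<close> truncates nothing and different r give different outcomes.\<close>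
  have nonneg: "\<forall>\<^sub>F N in sequentially. bin_nu p N - int R \<ge> 0"
  proof -
    have "filterlim (\<lambda>N. real N * p) at_top sequentially"
      using assms(1) by real_asymp
    then have "\<forall>\<^sub>F N in sequentially. real R \<le> real N * p"
      by (simp add: filterlim_at_top)
    then show ?thesis
      by eventually_elim (unfold bin_nu_def, linarith)
  qed
  \<comment> \<open>h stays in [0,1), so each t = h + r is bounded although it varies with
    N.\<close>
  have h: "(\<lambda>N. bin_h p N) \<in> O(\<lambda>_. 1)"
  proof (intro bigoI[of _ 1] always_eventually allI)
    fix N
    show "norm (bin_h p N) \<le> 1 * norm (1 :: real)"
      unfolding bin_h_def bin_nu_def real_norm_def by linarith
  qed
  have loc: "(\<lambda>N. s N * pmf (binomial_pmf N p) (k r N) - (1 + A1 (bin_h p N + of_int r) p / real N))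
      \<in> O(\<lambda>N. 1 / (real N)\<^sup>2)" if "r \<in> {- int R..int R}" for r
    unfolding s_def
  proof (rule binomial_pmf_local_bigo[OF assms])
    show "(\<lambda>N. bin_h p N + of_int r) \<in> O(\<lambda>_. 1)"
      using h by (intro sum_in_bigo) simp_all
    show "\<forall>\<^sub>F N in sequentially. real (k r N) = real N * p + (bin_h p N + of_int r)"
      using nonneg by eventually_elim (use that in \<open>auto simp: k_def bin_h_def\<close>)
  qed
  \<comment> \<open>The index set does not depend on N, so the local errors add up to O(N^(-2)); the
    2R+1 ones give the main term.\<close>
  have "(\<lambda>N. \<Sum>r = - int R..int R. s N * pmf (binomial_pmf N p) (k r N)
      - (1 + A1 (bin_h p N + of_int r) p / real N)) \<in> O(\<lambda>N. 1 / (real N)\<^sup>2)"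
    by (rule big_sum_in_bigo) (rule loc)
  moreover have "\<forall>\<^sub>F N in sequentially. (\<Sum>r = - int R..int R. s N * pmf (binomial_pmf N p) (k r N)
      - (1 + A1 (bin_h p N + of_int r) p / real N)) = E N"
    using nonneg
  proof eventually_elim
    case (elim N)
    have inj: "inj_on (\<lambda>r. k r N) {- int R..int R}"
      using elim by (auto simp: inj_on_def k_def)
    have "{X. \<bar>int X - bin_nu p N\<bar> \<le> int R} = (\<lambda>r. k r N) ` {- int R..int R}"
    proof (intro equalityI subsetI)
      fix X assume "X \<in> {X. \<bar>int X - bin_nu p N\<bar> \<le> int R}"
      then show "X \<in> (\<lambda>r. k r N) ` {- int R..int R}"
        by (intro image_eqI[of _ _ "int X - bin_nu p N"]) (auto simp: k_def)
    qed (use elim in \<open>auto simp: k_def\<close>)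
    then have "P N = (\<Sum>r = - int R..int R. pmf (binomial_pmf N p) (k r N))"
      unfolding P_def by (simp add: measure_measure_pmf_finite sum.reindex[OF inj])
    then show ?case
      by (simp add: E_def sum_subtractf sum.distrib sum_distrib_left sum_divide_distrib)
  qed
  ultimately have "E \<in> O(\<lambda>N. 1 / (real N)\<^sup>2)"
    by (rule bigo_eventually_eq)
  moreover have "P N = 1 / s N * (real (2 * R + 1)
      + 1 / real N * (\<Sum>r = - int R..int R. A1 (bin_h p N + of_int r) p) + E N)" if "N \<ge> 1" for N
  proof -
    have "s N > 0" using that assms by (simp add: s_def)
    then show ?thesis by (simp add: E_def)
  qed
  ultimately show "\<exists>E :: nat \<Rightarrow> real. E \<in> O(\<lambda>N. 1 / (real N)\<^sup>2) \<and>
      (\<forall>N\<ge>1. measure_pmf.prob (binomial_pmf N p) {X. \<bar>int X - bin_nu p N\<bar> \<le> int R}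
         = 1 / sqrt (2 * pi * real N * p * q) *
             (real (2 * R + 1)
              + 1 / real N * (\<Sum>r = - int R..int R. A1 (bin_h p N + of_int r) p)
              + E N))"
    unfolding P_def s_def by blast
qed

end
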